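(* Consider the pendulum skate system $\dot\zeta=f(\zeta)$, $\zeta=(v^1,v^2,v^3,\Gamma_2,\Gamma_3)$, defined in the context, and for $\Omega_0\in\mathbb R$ its spinning equilibrium $\zeta_{\rm sp}=(0,\Omega_0,0,0,1)$. Suppose that $I_3<I_2$. (i) If $I_3+ml^2<I_2$, then the spinning equilibrium $\zeta_{\rm sp}$ is unstable. (ii) If $$I_3+ml^2>I_2\qquad\text{and}\qquad|\Omega_0|>\sqrt{\frac{m\mathrm g l}{I_3+ml^2-I_2}},$$ then the spinning equilibrium $\zeta_{\rm sp}$ is stable.
   Context: Parameters: $m,l,\mathrm g,I_1,I_2,I_3>0$ (mass, distance from the blade--ice contact point to the center of mass, gravitational acceleration, principal moments of inertia), and $\bar I_i:=I_i+ml^2$ for $i=1,2$. The pendulum skate is a rigid pendulum attached to a skate blade sliding without friction on a horizontal plane, with no side-sliding, no pitching, and permanent contact; its reduced (nonholonomic Euler--Poincar\'e) equations, in quasivelocities $v^1,v^2,v^3$ and the components $(\Gamma_2,\Gamma_3)$ of the vertical unit vector $\mathbf\Gamma=(0,\Gamma_2,\Gamma_3)$ seen from the body frame (so that $\Gamma_2^2+\Gamma_3^2=1$ for the physical system), are $\dot\zeta=f(\zeta)$ with $$f(\zeta)=\Biggl(\frac{\bigl((\bar I_2-I_3)\Gamma_3(v^2)^2+m\mathrm g l\bigr)\Gamma_2+ml\,\Gamma_3v^2v^3}{\bar I_1},\ \frac{2(I_3-I_2)\Gamma_2\Gamma_3v^1v^2}{I_2\Gamma_2^2+I_3\Gamma_3^2},\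 -\frac{2lI_3\Gamma_3v^1v^2}{I_2\Gamma_2^2+I_3\Gamma_3^2},\ v^1\Gamma_3,\ -v^1\Gamma_2\Biggr).$$ Superscripts on $v$ are indices; $(v^2)^2$ is the square of $v^2$. "Stable" and "unstable" refer to Lyapunov stability of the equilibrium of this reduced system. *)

theory Defs
  imports "HOL-Analysis.Analysis"
begin

definition ode_solution ::
  "('a::real_normed_vector \<Rightarrow> 'a) \<Rightarrow> 'a set \<Rightarrow> real \<Rightarrow> (real \<Rightarrow> 'a) \<Rightarrow> bool" where
  "ode_solution f X T x \<longleftrightarrow>
     (\<forall>t\<in>{0..<T}. x t \<in> X \<and> (x has_vector_derivative f (x t)) (at t within {0..<T}))"

text \<open>Solutions on all half-open intervals are considered, not only global ones, so that a
  solution blowing up in finite time would also violate stability. For a locally Lipschitz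
  vector field, a solution that stays in a small closed ball around the equilibrium extends to
  all \<open>t \<ge> 0\<close>, so this agrees with the formulation by the flow.\<close>

definition lyapunov_stable ::
  "('a::real_normed_vector \<Rightarrow> 'a) \<Rightarrow> 'a set \<Rightarrow> 'a \<Rightarrow> bool" where
  "lyapunov_stable f X z \<longleftrightarrow>
     (\<forall>\<epsilon>>0. \<exists>\<delta>>0. \<forall>T x. ode_solution f X T x \<and> dist (x 0) z < \<delta> \<longrightarrow>
        (\<forall>t\<in>{0..<T}. dist (x t) z < \<epsilon>))"

abbreviation lyapunov_unstable ::
  "('a::real_normed_vector \<Rightarrow> 'a) \<Rightarrow> 'a set \<Rightarrow> 'a \<Rightarrow> bool" where
  "lyapunov_unstable f X z \<equiv> \<not> lyapunov_stable f X z"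

text \<open>A state is \<open>(v1, v2, v3, \<Gamma>2, \<Gamma>3)\<close>, where \<open>v1\<close>, \<open>v2\<close>, \<open>v3\<close> are the quasivelocities
  (superscripts in the usual notation). The product type carries the Euclidean norm.\<close>

type_synonym skate_state = "real \<times> real \<times> real \<times> real \<times> real"

fun skate_field ::
  "real \<Rightarrow> real \<Rightarrow> real \<Rightarrow> real \<Rightarrow> real \<Rightarrow> real \<Rightarrow> skate_state \<Rightarrow> skate_state" where
  "skate_field m l g I1 I2 I3 (v1, v2, v3, \<Gamma>2, \<Gamma>3) =
     (let J1 = I1 + m * l^2; J2 = I2 + m * l^2 in
      ((((J2 - I3) * \<Gamma>3 * v2^2 + m * g * l) * \<Gamma>2 + m * l * \<Gamma>3 * v2 * v3) / J1,
       (2 * (I3 - I2) * \<Gamma>2 * \<Gamma>3 * v1 * v2) / (I2 * \<Gamma>2^2 + I3 * \<Gamma>3^2),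
       - ((2 * l * I3 * \<Gamma>3 * v1 * v2) / (I2 * \<Gamma>2^2 + I3 * \<Gamma>3^2)),
       v1 * \<Gamma>3,
       - (v1 * \<Gamma>2)))"

text \<open>The full domain of the vector field (for positive \<open>I2\<close>, \<open>I3\<close> its denominators vanish
  exactly when \<open>\<Gamma>2 = \<Gamma>3 = 0\<close>), and the invariant set of physical states,
  where \<open>\<Gamma>\<close> is a unit vector.\<close>

definition skate_domain :: "skate_state set" where
  "skate_domain = {(v1, v2, v3, \<Gamma>2, \<Gamma>3). (\<Gamma>2, \<Gamma>3) \<noteq> (0, 0)}"

definition skate_physical :: "skate_state set" where
  "skate_physical = {(v1, v2, v3, \<Gamma>2, \<Gamma>3). \<Gamma>2^2 + \<Gamma>3^2 = 1}"

definition spinning_state :: "real \<Rightarrow> skate_state" where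
  "spinning_state \<Omega> = (0, \<Omega>, 0, 0, 1)"

lemma spinning_state_equilibrium:
  "skate_field m l g I1 I2 I3 (spinning_state \<Omega>) = 0"
  by (simp add: spinning_state_def Let_def zero_prod_def)

lemma spinning_state_physical: "spinning_state \<Omega> \<in> skate_physical"
  by (simp add: spinning_state_def skate_physical_def)

lemma skate_physical_subset_domain: "skate_physical \<subseteq> skate_domain"
  by (auto simp: skate_physical_def skate_domain_def)

end

theory Submission
  imports Defs
begin

text \<open>Write \<open>D = I2 \<Gamma>2^2 + I3 \<Gamma>3^2\<close>. Besides \<open>\<Gamma>2^2 + \<Gamma>3^2\<close> and the energy, the system conserves
  \<open>C = D v2\<close>. Then \<open>dv3 / d\<Gamma>2 = - 2 l I3 C / D^2\<close>, where \<open>D\<close> is a function of \<open>\<Gamma>2\<close> for fixed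
  \<open>\<Gamma>2^2 + \<Gamma>3^2\<close>, and integration gives a fourth invariant. On the common level set through the
  spinning equilibrium this leaves one degree of freedom in a potential whose second derivative at
  the equilibrium is \<open>(I3 + m l^2 - I2) \<Omega>^2 - m g l\<close>. If it is positive, the equilibrium is isolated
  in its level set, hence stable. If it is negative, energy conservation turns the motion on the level
  set into a separable scalar equation, whose solutions leave a fixed neighbourhood.\<close>

section \<open>Lyapunov stability: change of state set and a compactness criterion\<close>

lemma ode_solution_mono: "ode_solution f X T x \<Longrightarrow> X \<subseteq> Y \<Longrightarrow> ode_solution f Y T x"
  unfolding ode_solution_def by blast

text \<open>A smaller state set has fewer solutions. Hence stability is proved on
  \<open>skate_domain\<close> and passes down to \<open>skate_physical\<close>, while instability is
  proved on \<open>skate_physical\<close> and passes up.\<close>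

lemma lyapunov_stable_mono:
  assumes "lyapunov_stable f Y z" "X \<subseteq> Y"
  shows "lyapunov_stable f X z"
  unfolding lyapunov_stable_def
proof (intro allI impI)
  fix \<epsilon> :: real
  assume "\<epsilon> > 0"
  then obtain \<delta> where "\<delta> > 0" and \<delta>: "\<And>T x t. ode_solution f Y T x \<Longrightarrow> dist (x 0) z < \<delta> \<Longrightarrow> t \<in> {0..<T} \<Longrightarrow> dist (x t) z < \<epsilon>"
    using assms(1) unfolding lyapunov_stable_def by metis
  show "\<exists>\<delta>>0. \<forall>T x. ode_solution f X T x \<and> dist (x 0) z < \<delta> \<longrightarrow>
      (\<forall>t\<in>{0..<T}. dist (x t) z < \<epsilon>)"
  proof (intro exI[of _ \<delta>] conjI allI impI ballI \<open>\<delta> > 0\<close>)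
    fix T x t
    assume "ode_solution f X T x \<and> dist (x 0) z < \<delta>" "t \<in> {0..<T}"
    then show "dist (x t) z < \<epsilon>"
      using \<delta> ode_solution_mono[OF _ assms(2)] by metis
  qed
qed

text \<open>On a small sphere around z, compactness bounds the distance from V to V z below by some
  \<mu> > 0. A solution starting close enough to z keeps V within \<mu> of V z, so it cannot meet
  the sphere. Values of V in a metric space allow a tuple of conserved quantities to be used
  directly, without combining them into one definite Lyapunov function.\<close>

lemma lyapunov_stable_isolated_in_level_set:
  fixes f :: "'a::euclidean_space \<Rightarrow> 'a" and V :: "'a \<Rightarrow> 'b::metric_space"
  assumes "\<rho> > 0" and cont: "continuous_on (cball z \<rho>) V"
    and isolated: "\<And>x. x \<in> cball z \<rho> \<Longrightarrow> V x = V z \<Longrightarrow> x = z"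
    and invariant: "\<And>T x t. ode_solution f X T x \<Longrightarrow> t \<in> {0..<T} \<Longrightarrow> V (x t) = V (x 0)"
  shows "lyapunov_stable f X z"
  unfolding lyapunov_stable_def
proof (intro allI impI)
  fix \<epsilon> :: real
  assume "\<epsilon> > 0"
  define e where "e = min \<epsilon> \<rho>"
  have e: "0 < e" "e \<le> \<epsilon>" "e \<le> \<rho>"
    using \<open>\<epsilon> > 0\<close> \<open>\<rho> > 0\<close> by (auto simp: e_def)
  have "\<exists>\<mu>>0. \<forall>x\<in>sphere z e. \<mu> \<le> dist (V x) (V z)"
  proof (cases "sphere z e = {}")
    case False
    have "sphere z e \<subseteq> cball z \<rho>"
      using e by auto
    then have "continuous_on (sphere z e) (\<lambda>x. dist (V x) (V z))"
      by (intro continuous_intros continuous_on_subset[OF cont])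
    then obtain y where y: "y \<in> sphere z e" "\<And>x. x \<in> sphere z e \<Longrightarrow> dist (V y) (V z) \<le> dist (V x) (V z)"
      using continuous_attains_inf[OF compact_sphere False] by blast
    have "V y \<noteq> V z"
      using isolated[of y] y(1) e by auto
    then show ?thesis
      using y(2) by (intro exI[of _ "dist (V y) (V z)"]) auto
  qed (auto intro: zero_less_one)
  then obtain \<mu> where \<mu>: "\<mu> > 0" "\<And>x. x \<in> sphere z e \<Longrightarrow> \<mu> \<le> dist (V x) (V z)"
    by blast
  obtain d where d: "d > 0" "\<And>x. x \<in> cball z \<rho> \<Longrightarrow> dist x z < d \<Longrightarrow> dist (V x) (V z) < \<mu>"
    using cont \<mu>(1) \<open>\<rho> > 0\<close> unfolding continuous_on_iff by (metis centre_in_cball less_imp_le)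
  define \<delta> where "\<delta> = min d e"
  have "\<delta> > 0" using d e by (simp add: \<delta>_def)
  moreover have "dist (x t) z < \<epsilon>"
    if sol: "ode_solution f X T x" and start: "dist (x 0) z < \<delta>" and t: "t \<in> {0..<T}" for T x t
  proof (rule ccontr)
    assume "\<not> dist (x t) z < \<epsilon>"
    then have "e \<le> dist (x t) z" using e by simp
    moreover have "dist (x 0) z \<le> e" using start by (simp add: \<delta>_def)
    moreover have "continuous_on {0..<T} x"
      using sol unfolding ode_solution_def
      by (intro continuous_on_vector_derivative) blast
    then have "continuous_on {0..t} x"
      by (rule continuous_on_subset) (use t in auto)
    then have "continuous_on {0..t} (\<lambda>s. dist (x s) z)"
      by (intro continuous_intros)
    ultimately obtain s where s: "0 \<le> s" "s \<le> t" "dist (x s) z = e"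
      using IVT'[of "\<lambda>s. dist (x s) z" 0 e t] t by auto
    have "V (x s) = V (x 0)"
      using invariant[OF sol, of s] s t by auto
    moreover have "\<mu> \<le> dist (V (x s)) (V z)"
      using \<mu>(2)[of "x s"] s by (simp add: dist_commute)
    moreover have "dist (V (x 0)) (V z) < \<mu>"
      using d(2)[of "x 0"] start e by (simp add: \<delta>_def dist_commute)
    ultimately show False by simp
  qed
  ultimately show "\<exists>\<delta>>0. \<forall>T x. ode_solution f X T x \<and> dist (x 0) z < \<delta> \<longrightarrow>
      (\<forall>t\<in>{0..<T}. dist (x t) z < \<epsilon>)"
    by blast
qed

section \<open>Separable scalar equations\<close>

text \<open>Separation of variables: the travel time \<open>\<tau>\<close> is the integral of 1 / f,
  and its inverse is the solution. Positivity on a compact interval makes the total time T finite.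
  The image equation records that every point of [a, b) is reached.\<close>

lemma scalar_ode_solution:
  fixes f :: "real \<Rightarrow> real"
  assumes "a < b" and cont: "continuous_on {a..b} f" and pos: "\<And>s. s \<in> {a..b} \<Longrightarrow> f s > 0"
  obtains T y where "T > 0" "y 0 = a" "y ` {0..<T} = {a..<b}"
    "\<And>t. t \<in> {0..<T} \<Longrightarrow> (y has_real_derivative f (y t)) (at t)"
proof -
  \<comment> \<open>Extending f by constants beyond [a, b] makes a and b interior points of the
    domain of \<open>\<tau>\<close>, so that y has a two-sided derivative even at time 0.\<close>
  define h where "h s = f (max a (min b s))" for s
  have h_cont: "continuous_on A h" for A
    unfolding h_def using \<open>a < b\<close>
    by (intro continuous_on_compose2[OF cont] continuous_intros) auto
  have h_pos: "h s > 0" for s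
    unfolding h_def using \<open>a < b\<close> by (intro pos) auto
  have h_eq: "h s = f s" if "s \<in> {a..b}" for s
    using that by (auto simp: h_def)
  let ?S = "{a-1<..<b+1}"
  \<comment> \<open>The integral starts left of a so that it is differentiable at a; the shift in
    \<open>\<tau>\<close> then puts time 0 at a.\<close>
  define \<tau>0 where "\<tau>0 s = integral {a-1..s} (\<lambda>s. 1 / h s)" for s
  define \<tau> where "\<tau> s = \<tau>0 s - \<tau>0 a" for s
  have "(\<tau>0 has_real_derivative 1 / h s) (at s)" if "s \<in> ?S" for s
  proof -
    have "(\<tau>0 has_real_derivative 1 / h s) (at s within {a-1..b+1})"
      unfolding \<tau>0_def using that h_pos less_imp_neq[OF h_pos]
      by (intro integral_has_real_derivative continuous_intros h_cont) auto
    then show ?thesis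
      using that by (simp add: at_within_Icc_at)
  qed
  then have \<tau>_deriv: "(\<tau> has_real_derivative 1 / h s) (at s)" if "s \<in> ?S" for s
    unfolding \<tau>_def using that by (auto intro!: derivative_eq_intros)
  have \<tau>_mono: "\<tau> r < \<tau> s" if "r < s" "r \<in> ?S" "s \<in> ?S" for r s
  proof (rule DERIV_pos_imp_increasing[OF that(1)])
    fix u assume "r \<le> u" "u \<le> s"
    then have "u \<in> ?S" using that by auto
    then show "\<exists>d. DERIV \<tau> u :> d \<and> d > 0"
      using \<tau>_deriv[of u] h_pos[of u] by (intro exI[of _ "1 / h u"]) simp
  qed
  have inj: "inj_on \<tau> ?S"
    by (intro strict_mono_on_imp_inj_on strict_mono_onI \<tau>_mono)
  define y where "y = inv_into ?S \<tau>"
  have y_\<tau>: "y (\<tau> s) = s" if "s \<in> ?S" for s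
    unfolding y_def using inj that by (rule inv_into_f_f)
  have \<tau>_cont: "continuous_on ?S \<tau>"
    by (rule DERIV_continuous_on[OF has_field_derivative_at_within[OF \<tau>_deriv]])
  have y_deriv: "(y has_real_derivative h s) (at (\<tau> s))" if "s \<in> ?S" for s
    unfolding has_field_derivative_def
  proof (rule has_derivative_inverse_strong[OF open_greaterThanLessThan that \<tau>_cont y_\<tau>])
    show "(\<tau> has_derivative (*) (1 / h s)) (at s)"
      using \<tau>_deriv[OF that] by (simp only: has_field_derivative_def)
    show "(*) (1 / h s) \<circ> (*) (h s) = id"
      using h_pos[of s] by (auto simp: fun_eq_iff)
  qed
  have \<tau>a: "\<tau> a = 0" by (simp add: \<tau>_def)
  have img: "\<tau> ` {a..<b} = {0..<\<tau> b}"
  proof safe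
    fix s assume "s \<in> {a..<b}"
    then show "\<tau> s \<in> {0..<\<tau> b}"
      using \<tau>_mono[of a s] \<tau>_mono[of s b] \<tau>a by (cases "s = a") auto
  next
    fix t assume t: "t \<in> {0..<\<tau> b}"
    have "continuous_on {a..b} \<tau>"
      by (rule continuous_on_subset[OF \<tau>_cont]) auto
    then obtain s where "a \<le> s" "s \<le> b" "\<tau> s = t"
      using IVT'[of \<tau> a t b] t \<tau>a \<open>a < b\<close> by auto
    moreover have "s \<noteq> b" using t calculation by auto
    ultimately show "t \<in> \<tau> ` {a..<b}" by auto
  qed
  show thesis
  proof
    show "\<tau> b > 0" using \<tau>_mono[of a b] \<tau>a \<open>a < b\<close> by simp
    show "y 0 = a" using y_\<tau>[of a] \<tau>a \<open>a < b\<close> by simp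
    have "y ` \<tau> ` {a..<b} = {a..<b}"
      unfolding image_image by (intro image_cong[OF refl y_\<tau>, THEN trans] image_ident) auto
    then show "y ` {0..<\<tau> b} = {a..<b}" by (simp add: img)
    fix t assume "t \<in> {0..<\<tau> b}"
    then obtain s where s: "s \<in> {a..<b}" "t = \<tau> s" using img by blast
    then show "(y has_real_derivative f (y t)) (at t)"
      using y_deriv[of s] y_\<tau>[of s] h_eq[of s] by simp
  qed
qed

section \<open>An antiderivative of 1 / (c + k s^2)^2\<close>

text \<open>The standard antiderivative for positive c and k, normalised to vanish at 0.\<close>

definition recip_sq_primitive :: "real \<Rightarrow> real \<Rightarrow> real \<Rightarrow> real" where
  "recip_sq_primitive k c s =
     s / (2 * c * (c + k * s^2)) + arctan (s * sqrt (k / c)) / (2 * c * sqrt (c * k))"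

lemma recip_sq_primitive_0 [simp]: "recip_sq_primitive k c 0 = 0"
  by (simp add: recip_sq_primitive_def)

text \<open>With d = c + k s^2, the arctan term contributes 1 / (2 c d) and the rational term (2 c -
  d) / (2 c d^2); these add up to 1 / d^2.\<close>

lemma DERIV_recip_sq_primitive:
  assumes "k > 0" "c > 0"
  shows "(recip_sq_primitive k c has_real_derivative 1 / (c + k * s^2)^2) (at s)"
proof -
  have D: "c + k * s^2 > 0" using assms by (simp add: add_pos_nonneg)
  have r: "sqrt (k / c) = sqrt (c * k) / c" "sqrt (c * k) > 0"
    using assms by (simp_all add: real_sqrt_divide real_sqrt_mult field_simps)
  have r2: "1 + (s * sqrt (k / c))^2 = (c + k * s^2) / c"
    using assms by (simp add: power_mult_distrib field_simps)
  have "((\<lambda>s. arctan (s * sqrt (k / c)) / (2 * c * sqrt (c * k))) has_real_derivative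
      (sqrt (k / c) / (1 + (s * sqrt (k / c))^2)) / (2 * c * sqrt (c * k))) (at s)"
    by (rule DERIV_cdivide) (auto intro!: derivative_eq_intros simp: divide_inverse mult.commute)
  moreover have "(sqrt (k / c) / (1 + (s * sqrt (k / c))^2)) / (2 * c * sqrt (c * k)) =
      1 / (2 * c * (c + k * s^2))"
    unfolding r2 using r assms D by (simp add: divide_simps)
  ultimately have arctan_deriv: "((\<lambda>s. arctan (s * sqrt (k / c)) / (2 * c * sqrt (c * k)))
      has_real_derivative 1 / (2 * c * (c + k * s^2))) (at s)"
    by simp
  define d where "d = c + k * s^2"
  have d: "d > 0" "k * s^2 = d - c"
    using D by (simp_all add: d_def)
  have "((\<lambda>s. s / (2 * c * (c + k * s^2))) has_real_derivative
      (1 * (2 * c * d) - s * (2 * c * (k * (2 * s)))) / ((2 * c * d) * (2 * c * d))) (at s)"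
    using assms D unfolding d_def
    by (intro DERIV_quotient[unfolded power2_eq_square] derivative_eq_intros) auto
  moreover have "1 * (2 * c * d) - s * (2 * c * (k * (2 * s))) = 2 * c * (2 * c - d)"
    using d(2) by algebra
  moreover have "2 * c * (2 * c - d) / ((2 * c * d) * (2 * c * d)) = (2 * c - d) / (2 * c * d^2)"
    using assms d(1) by (simp add: field_simps power2_eq_square)
  ultimately have "((\<lambda>s. s / (2 * c * (c + k * s^2))) has_real_derivative
      (2 * c - d) / (2 * c * d^2)) (at s)"
    by simp
  from DERIV_add[OF this arctan_deriv]
  have "(recip_sq_primitive k c has_real_derivative (2 * c - d) / (2 * c * d^2) + 1 / (2 * c * d)) (at s)"
    unfolding recip_sq_primitive_def[abs_def] d_def .
  moreover have "(2 * c - d) / (2 * c * d^2) + 1 / (2 * c * d) = 1 / d^2"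
    using assms d(1) by (simp add: field_simps power2_eq_square)
  ultimately show ?thesis
    by (simp add: d_def)
qed

section \<open>The level set through the spinning equilibrium and its potential\<close>

locale skate =
  fixes m l g I1 I2 I3 :: real
  assumes pos: "m > 0" "l > 0" "g > 0" "I1 > 0" "I2 > 0" "I3 > 0"
    and I3_less_I2: "I3 < I2"
begin

abbreviation "field \<equiv> skate_field m l g I1 I2 I3"

definition "J1 = I1 + m * l^2"
text \<open>For a unit vector \<Gamma> the denominator of the field becomes I3 + k \<Gamma>2^2,
  which is \<open>denom\<close>. Positivity of k gives the primitive its arctan form.\<close>

definition "k = I2 - I3"

lemma J1_pos: "J1 > 0" and k_pos: "k > 0"
  using pos I3_less_I2 by (simp_all add: J1_def k_def add_pos_nonneg)

text \<open>On the level set of the invariants through the spinning equilibrium, \<open>v2\<close> and \<open>v3\<close> are the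
  functions \<open>spin\<close> and \<open>slide\<close> of \<open>\<Gamma>2\<close>.\<close>

definition "denom p = I3 + k * p^2"
definition "spin \<Omega> p = I3 * \<Omega> / denom p"
definition "slide \<Omega> p = - (2 * l * I3 * (I3 * \<Omega>) * recip_sq_primitive k I3 p)"
text \<open>The energy on this level set without its term in v1. The first summand is D v2^2 / 2
  rewritten through D v2 = I3 \<Omega>, and the square root is \<Gamma>3 on the branch through the
  equilibrium.\<close>

definition "potential \<Omega> p =
  (I3 * \<Omega>)^2 / (2 * denom p) + m / 2 * (slide \<Omega> p + l * p * spin \<Omega> p)^2 + m * g * l * sqrt (1 - p^2)"

lemma denom_pos: "denom p > 0"
  using pos k_pos by (simp add: denom_def add_pos_nonneg)

lemma DERIV_denom: "(denom has_real_derivative 2 * k * p) (at p)"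
  unfolding denom_def[abs_def] by (auto intro!: derivative_eq_intros)

lemma DERIV_spin: "(spin \<Omega> has_real_derivative - (2 * k * p * spin \<Omega> p / denom p)) (at p)"
  unfolding spin_def[abs_def] using denom_pos[of p]
  by (auto intro!: derivative_eq_intros DERIV_denom simp: field_simps power2_eq_square)

lemma DERIV_slide: "(slide \<Omega> has_real_derivative - (2 * l * I3 * spin \<Omega> p / denom p)) (at p)"
  unfolding slide_def[abs_def] spin_def
  by (rule derivative_eq_intros DERIV_recip_sq_primitive k_pos pos refl)+
    (simp add: denom_def power2_eq_square)

text \<open>The combination v3 + l \<Gamma>2 v2 enters the kinetic energy. Its derivative simplifies
  because the two terms over \<open>denom\<close> have coefficients 2 l I3 and 2 l k p^2, which sum
  to 2 l \<open>denom p\<close>.\<close>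

lemma DERIV_slip:
  "((\<lambda>p. slide \<Omega> p + l * p * spin \<Omega> p) has_real_derivative - (l * spin \<Omega> p)) (at p)"
proof -
  have "denom p * (- (2 * l * I3 * spin \<Omega> p / denom p) +
      (l * spin \<Omega> p + l * p * - (2 * k * p * spin \<Omega> p / denom p))) = denom p * - (l * spin \<Omega> p)"
    using denom_pos[of p] by (simp add: field_simps) (simp add: denom_def algebra_simps power2_eq_square)
  then have "- (2 * l * I3 * spin \<Omega> p / denom p) +
      (l * spin \<Omega> p + l * p * - (2 * k * p * spin \<Omega> p / denom p)) = - (l * spin \<Omega> p)"
    using denom_pos[of p] by (metis mult_left_cancel less_irrefl)
  moreover have "((\<lambda>p. slide \<Omega> p + l * p * spin \<Omega> p) has_real_derivative
      - (2 * l * I3 * spin \<Omega> p / denom p) + (l * spin \<Omega> p + l * p * - (2 * k * p * spin \<Omega> p / denom p))) (at p)"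
    by (auto intro!: derivative_eq_intros DERIV_spin DERIV_slide)
  ultimately show ?thesis by (simp only:)
qed

text \<open>Multiplied by \<Gamma>3 = sqrt (1 - p^2), this is J1 times the v1 component of the field
  on the level set.\<close>

definition "force \<Omega> p =
  k * p * (spin \<Omega> p)^2 + m * l * spin \<Omega> p * (slide \<Omega> p + l * p * spin \<Omega> p) + m * g * l * p / sqrt (1 - p^2)"

lemma DERIV_potential:
  assumes "\<bar>p\<bar> < 1"
  shows "(potential \<Omega> has_real_derivative - force \<Omega> p) (at p)"
proof -
  have q: "1 - p^2 > 0" using assms by (simp add: abs_square_less_1)
  have 1: "((\<lambda>p. (I3 * \<Omega>)^2 / (2 * denom p)) has_real_derivative - (k * p * (spin \<Omega> p)^2)) (at p)"
    using denom_pos[of p] unfolding spin_def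
    by (auto intro!: derivative_eq_intros DERIV_denom simp: field_simps power2_eq_square)
  have 2: "((\<lambda>p. m / 2 * (slide \<Omega> p + l * p * spin \<Omega> p)^2) has_real_derivative
      - (m * l * spin \<Omega> p * (slide \<Omega> p + l * p * spin \<Omega> p))) (at p)"
    by (rule derivative_eq_intros DERIV_slip refl)+ simp
  have 3: "((\<lambda>p. m * g * l * sqrt (1 - p^2)) has_real_derivative - (m * g * l * p / sqrt (1 - p^2))) (at p)"
    using q by (auto intro!: derivative_eq_intros simp: field_simps)
  show ?thesis
    using DERIV_add[OF DERIV_add[OF 1 2] 3] unfolding potential_def[abs_def] force_def by (simp add: algebra_simps)
qed

text \<open>The limit is half the second derivative of the potential at the equilibrium.\<close>

lemma potential_second_order:
  "((\<lambda>p. (potential \<Omega> p - potential \<Omega> 0) / p^2) \<longlongrightarrow>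
     ((m * l^2 - k) * \<Omega>^2 - m * g * l) / 2) (at 0)"
proof -
  have at0: "denom 0 = I3" "spin \<Omega> 0 = \<Omega>" "slide \<Omega> 0 = 0"
    using pos by (simp_all add: denom_def spin_def slide_def)
  \<comment> \<open>Since \<open>slide\<close> vanishes at 0, this is the limit of its difference
    quotient.\<close>
  have slope: "((\<lambda>p. slide \<Omega> p / p) \<longlongrightarrow> - (2 * l * \<Omega>)) (at 0)"
    using DERIV_slide[of \<Omega> 0] pos at0 by (simp add: DERIV_def mult.assoc)
  have [tendsto_intros]: "(denom \<longlongrightarrow> I3) (at 0)" "(spin \<Omega> \<longlongrightarrow> \<Omega>) (at 0)"
    using DERIV_isCont[OF DERIV_denom, of 0] DERIV_isCont[OF DERIV_spin, of 0 \<Omega>] at0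
    by (simp_all add: isCont_def)
  \<comment> \<open>This is the quotient after a factor p^2 has been pulled out of each of the three
    summands of the potential difference, so only first-order limits are required; \<open>ev\<close>
    justifies the rewriting.\<close>
  have lim: "((\<lambda>p. - (I3 * \<Omega>^2 * k / (2 * denom p)) + m / 2 * (slide \<Omega> p / p + l * spin \<Omega> p)^2
      - m * g * l / (1 + sqrt (1 - p^2))) \<longlongrightarrow>
      - (I3 * \<Omega>^2 * k / (2 * I3)) + m / 2 * (- (2 * l * \<Omega>) + l * \<Omega>)^2 - m * g * l / (1 + sqrt (1 - 0^2))) (at 0)"
    using pos by (intro tendsto_intros slope) auto
  have lim_eq: "- (I3 * \<Omega>^2 * k / (2 * I3)) + m / 2 * (- (2 * l * \<Omega>) + l * \<Omega>)^2 - m * g * l / (1 + sqrt (1 - 0^2))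
      = ((m * l^2 - k) * \<Omega>^2 - m * g * l) / 2"
    using pos by (simp add: field_simps power2_eq_square)
  have ev: "\<forall>\<^sub>F p in at 0. - (I3 * \<Omega>^2 * k / (2 * denom p)) + m / 2 * (slide \<Omega> p / p + l * spin \<Omega> p)^2
      - m * g * l / (1 + sqrt (1 - p^2)) = (potential \<Omega> p - potential \<Omega> 0) / p^2"
  proof -
    have "- (I3 * \<Omega>^2 * k / (2 * denom p)) + m / 2 * (slide \<Omega> p / p + l * spin \<Omega> p)^2
      - m * g * l / (1 + sqrt (1 - p^2)) = (potential \<Omega> p - potential \<Omega> 0) / p^2"
      if p: "p \<noteq> 0" "dist p 0 < 1" for p
    proof -
      have 1: "(I3 * \<Omega>)^2 / (2 * denom p) - (I3 * \<Omega>)^2 / (2 * I3) = p^2 * - (I3 * \<Omega>^2 * k / (2 * denom p))"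
        using pos denom_pos[of p]
        by (simp add: field_simps) (simp add: denom_def algebra_simps power2_eq_square)
      have 2: "(slide \<Omega> p + l * p * spin \<Omega> p)^2 = p^2 * (slide \<Omega> p / p + l * spin \<Omega> p)^2"
        unfolding power_mult_distrib[symmetric] using p by (simp add: algebra_simps)
      have 3: "sqrt (1 - p^2) - 1 = p^2 * - (1 / (1 + sqrt (1 - p^2)))"
      proof -
        have "1 - p^2 > 0" using p by (simp add: abs_square_less_1)
        then have "1 + sqrt (1 - p^2) > 0" "(sqrt (1 - p^2) - 1) * (1 + sqrt (1 - p^2)) = - (p^2)"
          by (auto simp: algebra_simps add_pos_nonneg)
        then show ?thesis by (simp add: field_simps)
      qed
      have "potential \<Omega> p - potential \<Omega> 0 = ((I3 * \<Omega>)^2 / (2 * denom p) - (I3 * \<Omega>)^2 / (2 * I3))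
          + m / 2 * (slide \<Omega> p + l * p * spin \<Omega> p)^2 + m * g * l * (sqrt (1 - p^2) - 1)"
        by (simp add: potential_def at0 right_diff_distrib)
      also have "\<dots> = p^2 * (- (I3 * \<Omega>^2 * k / (2 * denom p))
          + m / 2 * (slide \<Omega> p / p + l * spin \<Omega> p)^2 - m * g * l / (1 + sqrt (1 - p^2)))"
        unfolding 1 2 3 by (simp add: ring_distribs mult_ac)
      finally have "potential \<Omega> p - potential \<Omega> 0 = p^2 * (- (I3 * \<Omega>^2 * k / (2 * denom p))
          + m / 2 * (slide \<Omega> p / p + l * spin \<Omega> p)^2 - m * g * l / (1 + sqrt (1 - p^2)))" .
      then show ?thesis using p by simp
    qed
    then show ?thesis
      unfolding eventually_at by (intro exI[of _ 1]) auto
  qed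
  from Lim_transform_eventually[OF lim ev] show ?thesis
    unfolding lim_eq .
qed

section \<open>Four conserved quantities of the field\<close>

lemma ode_solution_skate_domainE:
  assumes "ode_solution field skate_domain T x"
  obtains a w u p q where
    "x = (\<lambda>t. (a t, w t, u t, p t, q t))"
    "\<And>t. t \<in> {0..<T} \<Longrightarrow> I2 * (p t)^2 + I3 * (q t)^2 > 0"
    "\<And>t. t \<in> {0..<T} \<Longrightarrow> (p t)^2 + (q t)^2 > 0"
    "\<And>t. t \<in> {0..<T} \<Longrightarrow> (a has_real_derivative
       ((((k + m * l^2) * q t * (w t)^2 + m * g * l) * p t + m * l * q t * w t * u t) / J1)) (at t within {0..<T})"
    "\<And>t. t \<in> {0..<T} \<Longrightarrow> (w has_real_derivative
       - (2 * k * p t * q t * a t * w t / (I2 * (p t)^2 + I3 * (q t)^2))) (at t within {0..<T})"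
    "\<And>t. t \<in> {0..<T} \<Longrightarrow> (u has_real_derivative
       - (2 * l * I3 * q t * a t * w t / (I2 * (p t)^2 + I3 * (q t)^2))) (at t within {0..<T})"
    "\<And>t. t \<in> {0..<T} \<Longrightarrow> (p has_real_derivative a t * q t) (at t within {0..<T})"
    "\<And>t. t \<in> {0..<T} \<Longrightarrow> (q has_real_derivative - (a t * p t)) (at t within {0..<T})"
proof -
  define a w u p q where comps: "a t = fst (x t)" "w t = fst (snd (x t))" "u t = fst (snd (snd (x t)))"
    "p t = fst (snd (snd (snd (x t))))" "q t = snd (snd (snd (snd (x t))))" for t
  have x: "x t = (a t, w t, u t, p t, q t)" for t
    by (simp add: comps)
  have in_domain: "(a t, w t, u t, p t, q t) \<in> skate_domain"
    and deriv: "(x has_vector_derivative field (a t, w t, u t, p t, q t)) (at t within {0..<T})"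
    if "t \<in> {0..<T}" for t
    using assms that unfolding ode_solution_def x[symmetric] by auto
  note fst_deriv = bounded_linear.has_vector_derivative[OF bounded_linear_fst]
  note snd_deriv = bounded_linear.has_vector_derivative[OF bounded_linear_snd]
  note fields = has_real_derivative_iff_has_vector_derivative
  have w_rhs: "2 * (I3 - I2) * P * Q * A * W / D = - (2 * k * P * Q * A * W / D)" for P Q A W D :: real
    by (simp add: k_def minus_divide_left algebra_simps)
  have "k + m * l^2 = I2 + m * l^2 - I3" by (simp add: k_def)
  note field_simp = this skate_field.simps Let_def fst_conv snd_conv J1_def w_rhs[symmetric]
  show thesis
  proof (rule that[of a w u p q])
    show "x = (\<lambda>t. (a t, w t, u t, p t, q t))" using x by blast
    fix t assume t: "t \<in> {0..<T}"
    show "(p t)^2 + (q t)^2 > 0"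
      using in_domain[OF t] by (simp add: skate_domain_def sum_power2_gt_zero_iff)
    show "I2 * (p t)^2 + I3 * (q t)^2 > 0"
      using in_domain[OF t] pos by (auto simp: skate_domain_def add_pos_nonneg add_nonneg_pos)
    note d1 = snd_deriv[OF deriv[OF t]] note d2 = snd_deriv[OF d1] note d3 = snd_deriv[OF d2]
    show "(a has_real_derivative
       ((((k + m * l^2) * q t * (w t)^2 + m * g * l) * p t + m * l * q t * w t * u t) / J1)) (at t within {0..<T})"
      using fst_deriv[OF deriv[OF t]] unfolding comps(1)[abs_def, symmetric] fields field_simp .
    show "(w has_real_derivative
       - (2 * k * p t * q t * a t * w t / (I2 * (p t)^2 + I3 * (q t)^2))) (at t within {0..<T})"
      using fst_deriv[OF d1] unfolding comps(2)[abs_def, symmetric] fields field_simp .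
    show "(u has_real_derivative
       - (2 * l * I3 * q t * a t * w t / (I2 * (p t)^2 + I3 * (q t)^2))) (at t within {0..<T})"
      using fst_deriv[OF d2] unfolding comps(3)[abs_def, symmetric] fields field_simp .
    show "(p has_real_derivative a t * q t) (at t within {0..<T})"
      using fst_deriv[OF d3] unfolding comps(4)[abs_def, symmetric] fields field_simp .
    show "(q has_real_derivative - (a t * p t)) (at t within {0..<T})"
      using snd_deriv[OF d3] unfolding comps(5)[abs_def, symmetric] fields field_simp .
  qed
qed

text \<open>The last invariant is the mechanical energy when \<open>\<Gamma>\<close> is a unit vector. The correction
  proportional to \<open>\<Gamma>2^2 + \<Gamma>3^2 - 1\<close> makes it invariant on the whole domain.\<close>

definition invariants :: "skate_state \<Rightarrow> real \<times> real \<times> real \<times> real" where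
  "invariants = (\<lambda>(a, w, u, p, q).
     (p^2 + q^2,
      w * (I2 * p^2 + I3 * q^2),
      u + 2 * l * I3 * (w * (I2 * p^2 + I3 * q^2)) * recip_sq_primitive k (I3 * (p^2 + q^2)) p,
      J1 * a^2 / 2 + (I2 * p^2 + I3 * q^2) * w^2 / 2 + m * (u + l * p * w)^2 / 2 + m * g * l * q
        + m * (p^2 + q^2 - 1) * (u^2 + I3 * l^2 / k * w^2) / 2))"

text \<open>The order matters: once R = \<Gamma>2^2 + \<Gamma>3^2 is constant, D = I3 R + k
  \<Gamma>2^2 depends on \<Gamma>2 alone. Together with the constancy of C = D v2, this lets the
  chain rule settle the third quantity; the corrected energy comes last.\<close>

lemma invariants_constant:
  assumes "ode_solution field skate_domain T x" "t \<in> {0..<T}"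
  shows "invariants (x t) = invariants (x 0)"
proof -
  obtain a w u p q where x: "x = (\<lambda>t. (a t, w t, u t, p t, q t))"
    and D_pos: "\<And>t. t \<in> {0..<T} \<Longrightarrow> I2 * (p t)^2 + I3 * (q t)^2 > 0"
    and R_pos: "\<And>t. t \<in> {0..<T} \<Longrightarrow> (p t)^2 + (q t)^2 > 0"
    and da: "\<And>t. t \<in> {0..<T} \<Longrightarrow> (a has_real_derivative
       ((((k + m * l^2) * q t * (w t)^2 + m * g * l) * p t + m * l * q t * w t * u t) / J1)) (at t within {0..<T})"
    and dw: "\<And>t. t \<in> {0..<T} \<Longrightarrow> (w has_real_derivative
       - (2 * k * p t * q t * a t * w t / (I2 * (p t)^2 + I3 * (q t)^2))) (at t within {0..<T})"
    and du: "\<And>t. t \<in> {0..<T} \<Longrightarrow> (u has_real_derivative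
       - (2 * l * I3 * q t * a t * w t / (I2 * (p t)^2 + I3 * (q t)^2))) (at t within {0..<T})"
    and dp: "\<And>t. t \<in> {0..<T} \<Longrightarrow> (p has_real_derivative a t * q t) (at t within {0..<T})"
    and dq: "\<And>t. t \<in> {0..<T} \<Longrightarrow> (q has_real_derivative - (a t * p t)) (at t within {0..<T})"
  proof (rule ode_solution_skate_domainE[OF assms(1)], goal_cases)
    case (1 a w u p q)
    show ?case by (rule 1(1)) (fact 1)+
  qed
  have constantI: "f r = f 0"
    if "\<And>s. s \<in> {0..<T} \<Longrightarrow> (f has_real_derivative 0) (at s within {0..<T})" "r \<in> {0..<T}"
    for f :: "real \<Rightarrow> real" and r
  proof -
    have "\<exists>c. \<forall>s\<in>{0..<T}. f s = c"
      by (intro has_field_derivative_zero_constant that(1)) auto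
    moreover have "0 \<in> {0..<T}" using that(2) by simp
    ultimately show ?thesis using that(2) by metis
  qed
  define R where "R = (p 0)^2 + (q 0)^2"
  define C where "C = w 0 * (I2 * (p 0)^2 + I3 * (q 0)^2)"
  have dR: "((\<lambda>t. (p t)^2 + (q t)^2) has_real_derivative 0) (at s within {0..<T})" if "s \<in> {0..<T}" for s
    by (rule derivative_eq_intros dp[OF that] dq[OF that] refl)+ (simp add: algebra_simps)
  have R: "(p s)^2 + (q s)^2 = R" if "s \<in> {0..<T}" for s
    unfolding R_def by (rule constantI[OF dR that])
  have dD: "((\<lambda>t. I2 * (p t)^2 + I3 * (q t)^2) has_real_derivative 2 * k * p s * q s * a s) (at s within {0..<T})"
    if "s \<in> {0..<T}" for s
    by (rule derivative_eq_intros dp[OF that] dq[OF that] refl)+ (simp add: k_def algebra_simps)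
  have dC: "((\<lambda>t. w t * (I2 * (p t)^2 + I3 * (q t)^2)) has_real_derivative 0) (at s within {0..<T})"
    if "s \<in> {0..<T}" for s
    by (rule derivative_eq_intros dw[OF that] dD[OF that] refl)+ (use D_pos[OF that] in simp)
  have C: "w s * (I2 * (p s)^2 + I3 * (q s)^2) = C" if "s \<in> {0..<T}" for s
    unfolding C_def by (rule constantI[OF dC that])
  have D: "I2 * (p s)^2 + I3 * (q s)^2 = I3 * R + k * (p s)^2" if "s \<in> {0..<T}" for s
    unfolding R[OF that, symmetric] by (simp add: k_def algebra_simps)
  have "R > 0" using R_pos[of 0] assms(2) by (simp add: R_def)
  have slide: "u t + 2 * l * I3 * C * recip_sq_primitive k (I3 * R) (p t) =
      u 0 + 2 * l * I3 * C * recip_sq_primitive k (I3 * R) (p 0)"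
  proof (rule constantI[OF _ assms(2)])
    fix s assume s: "s \<in> {0..<T}"
    define d where "d = I3 * R + k * (p s)^2"
    have d: "d > 0" "C = w s * d" using C[OF s] D[OF s] D_pos[OF s] by (simp_all add: d_def)
    have "(recip_sq_primitive k (I3 * R) has_real_derivative 1 / d^2) (at (p s))"
      unfolding d_def using \<open>R > 0\<close> pos k_pos by (intro DERIV_recip_sq_primitive) auto
    from DERIV_chain2[OF this dp[OF s]]
    have "((\<lambda>t. u t + 2 * l * I3 * C * recip_sq_primitive k (I3 * R) (p t)) has_real_derivative
        - (2 * l * I3 * q s * a s * w s / d) + 2 * l * I3 * C * (1 / d^2 * (a s * q s))) (at s within {0..<T})"
      using du[OF s] unfolding D[OF s] d_def[symmetric] by (intro DERIV_add DERIV_cmult)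
    moreover have "- (2 * l * I3 * q s * a s * w s / d) + 2 * l * I3 * C * (1 / d^2 * (a s * q s)) = 0"
      using d by (simp add: field_simps power2_eq_square)
    ultimately show "((\<lambda>t. u t + 2 * l * I3 * C * recip_sq_primitive k (I3 * R) (p t)) has_real_derivative 0)
        (at s within {0..<T})" by simp
  qed
  have energy: "J1 * (a t)^2 / 2 + (I2 * (p t)^2 + I3 * (q t)^2) * (w t)^2 / 2 + m * (u t + l * p t * w t)^2 / 2
        + m * g * l * q t + m * (R - 1) * ((u t)^2 + I3 * l^2 / k * (w t)^2) / 2 =
      J1 * (a 0)^2 / 2 + (I2 * (p 0)^2 + I3 * (q 0)^2) * (w 0)^2 / 2 + m * (u 0 + l * p 0 * w 0)^2 / 2
        + m * g * l * q 0 + m * (R - 1) * ((u 0)^2 + I3 * l^2 / k * (w 0)^2) / 2"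
  proof (rule constantI[OF _ assms(2)])
    fix s assume s: "s \<in> {0..<T}"
    define d where "d = I3 * R + k * (p s)^2"
    have d: "d > 0" using D[OF s] D_pos[OF s] by (simp add: d_def)
    define A' where "A' = (((k + m * l^2) * q s * (w s)^2 + m * g * l) * p s + m * l * q s * w s * u s) / J1"
    define W' where "W' = - (2 * k * p s * q s * a s * w s / d)"
    define U' where "U' = - (2 * l * I3 * q s * a s * w s / d)"
    note d_rate = dD[OF s] da[OF s, folded A'_def] dw[OF s, unfolded D[OF s], folded d_def, folded W'_def]
       du[OF s, unfolded D[OF s], folded d_def, folded U'_def] dp[OF s] dq[OF s]
    \<comment> \<open>This coefficient gives c W' = l p U', so the correction has derivative m (R -
      1) (u + l p w) U'. It shares the factor u + l p w with the derivative of the kinetic term and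
      merely replaces U' there by R U'.\<close>
    define c where "c = I3 * l^2 / k"
    have rates: "J1 * A' = ((k + m * l^2) * q s * (w s)^2 + m * g * l) * p s + m * l * q s * w s * u s"
      "d * W' = - (2 * k * p s * q s * a s * w s)" "d * U' = - (2 * l * I3 * q s * a s * w s)"
      "c * W' = l * p s * U'"
      using d J1_pos k_pos by (simp_all add: A'_def W'_def U'_def c_def field_simps power2_eq_square)
    \<comment> \<open>The counterpart of \<open>DERIV_slip\<close> for arbitrary R: the factor R on
      U' is what completes I3 R + k p^2 = d.\<close>
    have "d * (U' * R + l * (a s * q s * w s + p s * W')) = d * (- (l * q s * a s * w s))"
    proof -
      have "d * (U' * R + l * (a s * q s * w s + p s * W')) =
          R * (d * U') + l * (a s * q s * w s) * d + l * p s * (d * W')"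
        by algebra
      then show ?thesis
        unfolding rates unfolding d_def by algebra
    qed
    then have slip: "U' * R + l * (a s * q s * w s + p s * W') = - (l * q s * a s * w s)"
      using d by (metis mult_left_cancel less_irrefl)
    have "((\<lambda>t. J1 * (a t)^2 / 2) has_real_derivative J1 * A' * a s) (at s within {0..<T})"
      by (auto intro!: derivative_eq_intros d_rate)
    moreover have "((\<lambda>t. (I2 * (p t)^2 + I3 * (q t)^2) * (w t)^2 / 2) has_real_derivative
        k * p s * q s * a s * (w s)^2 + d * W' * w s) (at s within {0..<T})"
      unfolding D[OF s, folded d_def, symmetric]
      by (rule DERIV_cong, rule DERIV_cdivide, (rule derivative_eq_intros d_rate refl)+) (simp add: algebra_simps)
    moreover have "((\<lambda>t. m * (u t + l * p t * w t)^2 / 2) has_real_derivative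
        m * (u s + l * p s * w s) * (U' + l * (a s * q s * w s + p s * W'))) (at s within {0..<T})"
      by (rule DERIV_cong, rule DERIV_cdivide, (rule derivative_eq_intros d_rate refl)+) (simp add: algebra_simps)
    moreover have "((\<lambda>t. m * g * l * q t) has_real_derivative - (m * g * l * (a s * p s))) (at s within {0..<T})"
      by (auto intro!: derivative_eq_intros d_rate)
    moreover have "((\<lambda>t. m * (R - 1) * ((u t)^2 + c * (w t)^2) / 2) has_real_derivative
        m * (R - 1) * (u s * U' + c * W' * w s)) (at s within {0..<T})"
      by (rule DERIV_cong, rule DERIV_cdivide, (rule derivative_eq_intros d_rate refl)+) (simp add: field_simps)
    ultimately have "((\<lambda>t. J1 * (a t)^2 / 2 + (I2 * (p t)^2 + I3 * (q t)^2) * (w t)^2 / 2 + m * (u t + l * p t * w t)^2 / 2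
        + m * g * l * q t + m * (R - 1) * ((u t)^2 + c * (w t)^2) / 2) has_real_derivative
       J1 * A' * a s + (k * p s * q s * a s * (w s)^2 + d * W' * w s)
        + m * (u s + l * p s * w s) * (U' + l * (a s * q s * w s + p s * W'))
        + - (m * g * l * (a s * p s)) + m * (R - 1) * (u s * U' + c * W' * w s)) (at s within {0..<T})"
      by (intro DERIV_add)
    moreover have "J1 * A' * a s + (k * p s * q s * a s * (w s)^2 + d * W' * w s)
        + m * (u s + l * p s * w s) * (U' + l * (a s * q s * w s + p s * W'))
        + - (m * g * l * (a s * p s)) + m * (R - 1) * (u s * U' + c * W' * w s) = 0"
    proof -
      have "m * (u s + l * p s * w s) * (U' + l * (a s * q s * w s + p s * W')) + m * (R - 1) * (u s * U' + c * W' * w s)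
        = m * (u s + l * p s * w s) * (U' * R + l * (a s * q s * w s + p s * W'))"
        unfolding rates by algebra
      then show ?thesis
        unfolding slip rates by algebra
    qed
    ultimately show "((\<lambda>t. J1 * (a t)^2 / 2 + (I2 * (p t)^2 + I3 * (q t)^2) * (w t)^2 / 2
        + m * (u t + l * p t * w t)^2 / 2 + m * g * l * q t
        + m * (R - 1) * ((u t)^2 + I3 * l^2 / k * (w t)^2) / 2) has_real_derivative 0) (at s within {0..<T})"
      by (simp add: c_def)
  qed
  show ?thesis
    using slide energy unfolding x invariants_def
    by (simp add: R[OF assms(2)] R_def[symmetric] C[OF assms(2)] C_def[symmetric])
qed

section \<open>Stability at a strict minimum of the potential\<close>

lemma continuous_on_recip_sq_primitive:
  assumes "continuous_on A c" "continuous_on A f" "\<And>x. x \<in> A \<Longrightarrow> c x > 0"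
  shows "continuous_on A (\<lambda>x. recip_sq_primitive k (c x) (f x))"
proof -
  have "c x + k * (f x)^2 > 0" if "x \<in> A" for x
    using assms(3)[OF that] k_pos by (simp add: add_pos_nonneg)
  then show ?thesis
    unfolding recip_sq_primitive_def using assms(3) k_pos
    by (intro continuous_intros assms(1,2)) (auto dest: assms(3) simp: less_imp_neq[symmetric])
qed

lemma dist_spinning_state:
  "\<bar>p\<bar> \<le> dist (a, w, u, p, q) (spinning_state \<Omega>)" "\<bar>q - 1\<bar> \<le> dist (a, w, u, p, q) (spinning_state \<Omega>)"
proof -
  have "dist (p, q) (0, 1) \<le> dist (u, p, q) (0, 0, 1)"
    using dist_snd_le[of "(u, p, q)" "(0, 0, 1)"] by simp
  also have "\<dots> \<le> dist (w, u, p, q) (\<Omega>, 0, 0, 1)"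
    using dist_snd_le[of "(w, u, p, q)" "(\<Omega>, 0, 0, 1)"] by simp
  also have "\<dots> \<le> dist (a, w, u, p, q) (spinning_state \<Omega>)"
    using dist_snd_le[of "(a, w, u, p, q)" "(0, \<Omega>, 0, 0, 1)"] by (simp add: spinning_state_def)
  finally show "\<bar>p\<bar> \<le> dist (a, w, u, p, q) (spinning_state \<Omega>)" "\<bar>q - 1\<bar> \<le> dist (a, w, u, p, q) (spinning_state \<Omega>)"
    using dist_fst_le[of "(p, q)" "(0, 1)"] dist_snd_le[of "(p, q)" "(0, 1)"] by (simp_all add: dist_real_def)
qed

text \<open>Being within \<rho> < 1 of the equilibrium forces \<Gamma>3 > 0, which selects the
  positive root. The first three invariants then express all coordinates but v1 through \<Gamma>2,
  and the energy becomes J1 v1^2 / 2 + \<open>potential \<Omega> p\<close> =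
  \<open>potential \<Omega> 0\<close>. The strict minimum leaves only \<Gamma>2 = 0 and v1 =
  0.\<close>

lemma invariants_isolated:
  assumes minimum: "\<And>p. p \<noteq> 0 \<Longrightarrow> \<bar>p\<bar> \<le> \<rho> \<Longrightarrow> potential \<Omega> 0 < potential \<Omega> p" and "\<rho> < 1"
    and near: "x \<in> cball (spinning_state \<Omega>) \<rho>" and eq: "invariants x = invariants (spinning_state \<Omega>)"
  shows "x = spinning_state \<Omega>"
proof -
  obtain a w u p q where x: "x = (a, w, u, p, q)" by (rule prod_cases5)
  have p: "\<bar>p\<bar> \<le> \<rho>" and "\<bar>q - 1\<bar> \<le> \<rho>"
    using near dist_spinning_state[of p a w u q \<Omega>] dist_spinning_state[of q a w u p \<Omega>] unfolding x
    by (auto simp: dist_commute)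
  then have "q > 0" using \<open>\<rho> < 1\<close> by simp
  have R: "p^2 + q^2 = 1" and C: "w * (I2 * p^2 + I3 * q^2) = I3 * \<Omega>"
    using eq by (simp_all add: x invariants_def spinning_state_def)
  have q: "q = sqrt (1 - p^2)"
    using R \<open>q > 0\<close> by (intro real_sqrt_unique[symmetric]) auto
  have D: "I2 * p^2 + I3 * q^2 = denom p"
    using R unfolding denom_def k_def by algebra
  have w: "w = spin \<Omega> p"
    using C denom_pos[of p] unfolding D spin_def by (simp add: field_simps)
  have u: "u = slide \<Omega> p"
    using eq unfolding x by (simp add: invariants_def spinning_state_def R C slide_def)
  have "J1 * a^2 / 2 + denom p * w^2 / 2 + m * (u + l * p * w)^2 / 2 + m * g * l * q = I3 * \<Omega>^2 / 2 + m * g * l"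
    using eq unfolding x by (simp add: invariants_def spinning_state_def R D)
  moreover have "denom p * w^2 / 2 = (I3 * \<Omega>)^2 / (2 * denom p)"
    using denom_pos[of p] by (simp add: w spin_def field_simps power2_eq_square)
  moreover have "potential \<Omega> 0 = I3 * \<Omega>^2 / 2 + m * g * l"
    using pos by (simp add: potential_def denom_def slide_def field_simps power2_eq_square)
  ultimately have energy: "J1 * a^2 / 2 + potential \<Omega> p = potential \<Omega> 0"
    unfolding potential_def w u q by simp
  have "J1 * a^2 / 2 \<ge> 0" using J1_pos by simp
  then have "p = 0" using minimum[OF _ p] energy by force
  then show ?thesis
    using energy J1_pos pos unfolding x w u q
    by (simp add: spinning_state_def spin_def slide_def denom_def)
qed

lemma spinning_stable:
  assumes "(m * l^2 - k) * \<Omega>^2 > m * g * l"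
  shows "lyapunov_stable field skate_domain (spinning_state \<Omega>)"
proof -
  have "((m * l^2 - k) * \<Omega>^2 - m * g * l) / 2 > 0" using assms by simp
  then have "\<forall>\<^sub>F p in at 0. (potential \<Omega> p - potential \<Omega> 0) / p^2 > 0"
    by (rule order_tendstoD(1)[OF potential_second_order])
  then obtain r where r: "r > 0"
    "\<And>p. p \<noteq> 0 \<Longrightarrow> dist p 0 < r \<Longrightarrow> (potential \<Omega> p - potential \<Omega> 0) / p^2 > 0"
    unfolding eventually_at by auto
  \<comment> \<open>Halving r puts the closed ball inside the open range where the quotient is
    positive; the bound 1 / 2 keeps \<Gamma>3 positive, and with it the parameter of the primitive
    in the third invariant.\<close>
  define \<rho> where "\<rho> = min (r / 2) (1 / 2)"
  have \<rho>: "\<rho> > 0" "\<rho> < r" "\<rho> < 1" using r(1) by (auto simp: \<rho>_def)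
  have minimum: "potential \<Omega> 0 < potential \<Omega> p" if "p \<noteq> 0" "\<bar>p\<bar> \<le> \<rho>" for p
    using r(2)[of p] that \<rho> by (auto simp: zero_less_divide_iff)
  have "continuous_on (cball (spinning_state \<Omega>) \<rho>) invariants"
  proof -
    have "snd (snd (snd (snd x))) > 0" if "x \<in> cball (spinning_state \<Omega>) \<rho>" for x
    proof -
      obtain a w u p q where x: "x = (a, w, u, p, q)" by (rule prod_cases5)
      show ?thesis
        using that \<rho>(3) dist_spinning_state(2)[of q a w u p \<Omega>] unfolding x by (auto simp: dist_commute)
    qed
    then have "I3 * ((fst (snd (snd (snd x))))^2 + (snd (snd (snd (snd x))))^2) > 0"
      if "x \<in> cball (spinning_state \<Omega>) \<rho>" for x
      using pos that by (metis less_irrefl mult_pos_pos sum_power2_gt_zero_iff)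
    then show ?thesis
      unfolding invariants_def case_prod_unfold using k_pos
      by (intro continuous_intros continuous_on_recip_sq_primitive) auto
  qed
  from lyapunov_stable_isolated_in_level_set[where V = invariants, OF \<rho>(1) this] show ?thesis
    using invariants_isolated[OF minimum \<rho>(3)] invariants_constant by metis
qed

section \<open>Instability along an escaping orbit\<close>

text \<open>The part \<open>v1 \<ge> 0\<close> of the level set of the invariants through the spinning equilibrium.\<close>

definition "speed \<Omega> p = sqrt (2 * (potential \<Omega> 0 - potential \<Omega> p) / J1)"
definition "orbit \<Omega> p = (speed \<Omega> p, spin \<Omega> p, slide \<Omega> p, p, sqrt (1 - p^2))"

lemma orbit_0: "orbit \<Omega> 0 = spinning_state \<Omega>"
  using pos by (simp add: orbit_def speed_def spin_def slide_def denom_def spinning_state_def)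

lemma orbit_physical: "\<bar>p\<bar> < 1 \<Longrightarrow> orbit \<Omega> p \<in> skate_physical"
  by (simp add: orbit_def skate_physical_def abs_square_less_1 less_imp_le)

lemma continuous_on_orbit:
  assumes "A \<subseteq> {-1<..<1}"
  shows "continuous_on A (speed \<Omega>)" "continuous_on A (orbit \<Omega>)"
proof -
  have cont: "continuous_on A (spin \<Omega>)" "continuous_on A (slide \<Omega>)"
    by (rule DERIV_continuous_on, rule has_field_derivative_at_within, rule DERIV_spin DERIV_slide)+
  have "\<bar>p\<bar> < 1" if "p \<in> A" for p
    using subsetD[OF assms that] by auto
  from DERIV_potential[OF this] have "continuous_on A (potential \<Omega>)"
    by (rule DERIV_continuous_on[OF has_field_derivative_at_within])
  then show speed: "continuous_on A (speed \<Omega>)"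
    \<comment> \<open>In Isabelle \<open>sqrt\<close> is continuous on all reals, including negative
      radicands.\<close>
    unfolding speed_def[abs_def] using J1_pos by (intro continuous_intros) auto
  show "continuous_on A (orbit \<Omega>)"
    unfolding orbit_def[abs_def] by (intro continuous_intros speed cont)
qed

text \<open>Differentiating the energy relation gives v v' = \<open>force\<close> / J1 with respect
  to p, where \<open>descent\<close> makes v positive and the root differentiable. The time change
  dp/dt = \<Gamma>3 v turns the tangent of the curve into the field.\<close>

lemma orbit_derivative:
  assumes p: "\<bar>p\<bar> < 1" and descent: "potential \<Omega> p < potential \<Omega> 0"
    and y: "y t = p" "(y has_real_derivative sqrt (1 - p^2) * speed \<Omega> p) (at t)"
  shows "((\<lambda>t. orbit \<Omega> (y t)) has_vector_derivative field (orbit \<Omega> p)) (at t)"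
proof -
  define v q where "v = speed \<Omega> p" and "q = sqrt (1 - p^2)"
  have "1 - p^2 > 0" using p by (simp add: abs_square_less_1)
  then have q: "q > 0" "q^2 = 1 - p^2" by (simp_all add: q_def)
  have v: "v > 0" using descent J1_pos by (simp add: v_def speed_def)
  have "((\<lambda>p. 2 * (potential \<Omega> 0 - potential \<Omega> p) / J1) has_real_derivative 2 * force \<Omega> p / J1) (at p)"
    using J1_pos by (auto intro!: derivative_eq_intros DERIV_potential p)
  from DERIV_chain2[OF DERIV_real_sqrt this] descent J1_pos
  have dspeed: "(speed \<Omega> has_real_derivative force \<Omega> p / (J1 * v)) (at p)"
    unfolding v_def speed_def[abs_def] by (simp add: field_simps)
  have dq: "((\<lambda>p. sqrt (1 - p^2)) has_real_derivative - (p / q)) (at p)"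
    using q unfolding q_def by (auto intro!: derivative_eq_intros simp: field_simps)
  have denom_eq: "I2 * p^2 + I3 * q^2 = denom p"
    unfolding q by (simp add: denom_def k_def algebra_simps)
  have "(orbit \<Omega> has_vector_derivative
      (force \<Omega> p / (J1 * v), - (2 * k * p * spin \<Omega> p / denom p), - (2 * l * I3 * spin \<Omega> p / denom p), 1, - (p / q))) (at p)"
    unfolding orbit_def[abs_def] using dspeed DERIV_spin DERIV_slide dq DERIV_ident[of "at p"]
    unfolding has_real_derivative_iff_has_vector_derivative
    by (intro has_vector_derivative_Pair)
  then have "((\<lambda>t. orbit \<Omega> (y t)) has_vector_derivative (q * v) *\<^sub>R
      (force \<Omega> p / (J1 * v), - (2 * k * p * spin \<Omega> p / denom p), - (2 * l * I3 * spin \<Omega> p / denom p), 1, - (p / q))) (at t)"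
    using vector_diff_chain_at[of y "q * v" t "orbit \<Omega>"] y
    unfolding has_real_derivative_iff_has_vector_derivative o_def q_def v_def by metis
  moreover have "(q * v) *\<^sub>R
      (force \<Omega> p / (J1 * v), - (2 * k * p * spin \<Omega> p / denom p), - (2 * l * I3 * spin \<Omega> p / denom p), 1, - (p / q))
      = field (orbit \<Omega> p)"
  proof -
    have "q * force \<Omega> p = ((I2 + m * l^2 - I3) * q * (spin \<Omega> p)^2 + m * g * l) * p + m * l * q * spin \<Omega> p * slide \<Omega> p"
      using q(1) unfolding force_def q_def[symmetric] k_def by (simp add: algebra_simps power2_eq_square)
    then have "q * v * (force \<Omega> p / (J1 * v)) =
        (((I2 + m * l^2 - I3) * q * (spin \<Omega> p)^2 + m * g * l) * p + m * l * q * spin \<Omega> p * slide \<Omega> p) / J1"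
      using v by simp
    moreover have "q * v * - (2 * k * p * spin \<Omega> p / denom p) = 2 * (I3 - I2) * p * q * v * spin \<Omega> p / denom p"
      by (simp add: k_def minus_divide_left algebra_simps)
    moreover have "q * v * - (2 * l * I3 * spin \<Omega> p / denom p) = - (2 * l * I3 * q * v * spin \<Omega> p / denom p)"
      by (simp add: algebra_simps)
    moreover have "q * v * - (p / q) = - (v * p)"
      using q(1) by simp
    ultimately show ?thesis
      unfolding orbit_def v_def[symmetric] q_def[symmetric]
      by (simp add: Let_def denom_eq J1_def[symmetric] mult.commute)
  qed
  ultimately show ?thesis by simp
qed

text \<open>Along the orbit, \<open>\<Gamma>2\<close> solves the separable equation
  \<open>\<Gamma>2' = sqrt (1 - \<Gamma>2^2) * speed \<Omega> \<Gamma>2\<close>.\<close>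

lemma spinning_unstable:
  assumes "(m * l^2 - k) * \<Omega>^2 < m * g * l"
  shows "lyapunov_unstable field skate_physical (spinning_state \<Omega>)"
proof
  assume stable: "lyapunov_stable field skate_physical (spinning_state \<Omega>)"
  have "((m * l^2 - k) * \<Omega>^2 - m * g * l) / 2 < 0" using assms by simp
  then have "\<forall>\<^sub>F p in at 0. (potential \<Omega> p - potential \<Omega> 0) / p^2 < 0"
    by (rule order_tendstoD(2)[OF potential_second_order])
  then obtain r where r: "r > 0"
    "\<And>p. p \<noteq> 0 \<Longrightarrow> dist p 0 < r \<Longrightarrow> (potential \<Omega> p - potential \<Omega> 0) / p^2 < 0"
    unfolding eventually_at by auto
  define b where "b = min (r / 2) (1 / 2)"
  have b: "b > 0" "b < r" "b < 1" using r(1) by (auto simp: b_def)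
  have descent: "potential \<Omega> p < potential \<Omega> 0" if "0 < p" "p \<le> b" for p
    using r(2)[of p] that b by (auto simp: divide_less_0_iff)
  \<comment> \<open>The radius to be violated is b / 2: the solution constructed below attains
    \<Gamma>2 = b / 2 but not b, and |\<Gamma>2| bounds the distance to the equilibrium from
    below.\<close>
  have "b / 2 > 0" using b by simp
  then obtain \<delta> where \<delta>: "\<delta> > 0"
    "\<And>T x t. ode_solution field skate_physical T x \<Longrightarrow> dist (x 0) (spinning_state \<Omega>) < \<delta> \<Longrightarrow>
       t \<in> {0..<T} \<Longrightarrow> dist (x t) (spinning_state \<Omega>) < b / 2"
    using stable unfolding lyapunov_stable_def by metis
  have "continuous_on {-1<..<1} (orbit \<Omega>)"
    by (rule continuous_on_orbit) simp
  then obtain \<eta> where \<eta>: "\<eta> > 0"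
    "\<And>p. p \<in> {-1<..<1} \<Longrightarrow> dist p 0 < \<eta> \<Longrightarrow> dist (orbit \<Omega> p) (orbit \<Omega> 0) < \<delta>"
    using \<delta>(1) unfolding continuous_on_iff by (metis greaterThanLessThan_iff neg_less_0_iff_less zero_less_one)
  \<comment> \<open>Starting below \<eta> puts the initial state within \<delta> of the equilibrium,
    and a \<le> b / 2 ensures that b / 2 is still reached.\<close>
  define a where "a = min (b / 2) (\<eta> / 2)"
  have a: "a > 0" "a \<le> b / 2" "a < b" "a < 1" "a < \<eta>" using b \<eta>(1) by (auto simp: a_def)
  have f_cont: "continuous_on {a..b} (\<lambda>p. sqrt (1 - p^2) * speed \<Omega> p)"
    using a b by (intro continuous_intros continuous_on_orbit) auto
  have f_pos: "sqrt (1 - p^2) * speed \<Omega> p > 0" if "p \<in> {a..b}" for p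
  proof (rule mult_pos_pos)
    show "sqrt (1 - p^2) > 0" using that a b by (simp add: abs_square_less_1)
    show "speed \<Omega> p > 0" using that a descent[of p] J1_pos by (simp add: speed_def)
  qed
  obtain T y where y: "T > 0" "y 0 = a" "y ` {0..<T} = {a..<b}"
    "\<And>t. t \<in> {0..<T} \<Longrightarrow> (y has_real_derivative sqrt (1 - (y t)^2) * speed \<Omega> (y t)) (at t)"
  proof (rule scalar_ode_solution[OF \<open>a < b\<close> f_cont], goal_cases)
    case (1 p)
    show ?case by (rule f_pos[OF 1(2)])
  next
    case (2 T y)
    show ?case by (rule 2(1)) (fact 2)+
  qed
  have range: "0 < y t" "y t \<le> b" "\<bar>y t\<bar> < 1" if "t \<in> {0..<T}" for t
  proof -
    have "y t \<in> {a..<b}" using y(3) that by blast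
    then show "0 < y t" "y t \<le> b" "\<bar>y t\<bar> < 1" using a b by auto
  qed
  have sol: "ode_solution field skate_physical T (\<lambda>t. orbit \<Omega> (y t))"
    unfolding ode_solution_def
  proof (intro ballI conjI)
    fix t assume t: "t \<in> {0..<T}"
    show "orbit \<Omega> (y t) \<in> skate_physical"
      by (rule orbit_physical[OF range(3)[OF t]])
    show "((\<lambda>t. orbit \<Omega> (y t)) has_vector_derivative field (orbit \<Omega> (y t))) (at t within {0..<T})"
      by (rule has_vector_derivative_at_within[OF
        orbit_derivative[OF range(3)[OF t] descent[OF range(1,2)[OF t]] refl y(4)[OF t]]])
  qed
  have start: "dist (orbit \<Omega> (y 0)) (spinning_state \<Omega>) < \<delta>"
    using \<eta>(2)[of a] a y(2) by (simp add: orbit_0)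
  have "b / 2 \<in> y ` {0..<T}" unfolding y(3) using a b by simp
  then obtain t where t: "t \<in> {0..<T}" "y t = b / 2" by auto
  have "dist (orbit \<Omega> (y t)) (spinning_state \<Omega>) < b / 2"
    using \<delta>(2)[OF sol start t(1)] .
  moreover have "\<bar>y t\<bar> \<le> dist (orbit \<Omega> (y t)) (spinning_state \<Omega>)"
    unfolding orbit_def by (rule dist_spinning_state)
  ultimately show False using t(2) b by simp
qed

end

section \<open>The two parameter regimes\<close>

theorem proposition14:
  fixes m l g I1 I2 I3 \<Omega>0 :: real
  assumes "m > 0" "l > 0" "g > 0" "I1 > 0" "I2 > 0" "I3 > 0"
    and "I3 < I2"
  shows
    "(I3 + m * l^2 < I2 \<longrightarrow>
        lyapunov_unstable (skate_field m l g I1 I2 I3) skate_domain (spinning_state \<Omega>0) \<and>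
        lyapunov_unstable (skate_field m l g I1 I2 I3) skate_physical (spinning_state \<Omega>0)) \<and>
     (I3 + m * l^2 > I2 \<and> \<bar>\<Omega>0\<bar> > sqrt (m * g * l / (I3 + m * l^2 - I2)) \<longrightarrow>
        lyapunov_stable (skate_field m l g I1 I2 I3) skate_domain (spinning_state \<Omega>0) \<and>
        lyapunov_stable (skate_field m l g I1 I2 I3) skate_physical (spinning_state \<Omega>0))"
proof -
  interpret skate m l g I1 I2 I3
    by unfold_locales fact+
  have unstable_domain: "lyapunov_unstable field skate_domain z"
    if "lyapunov_unstable field skate_physical z" for z
    using that lyapunov_stable_mono[OF _ skate_physical_subset_domain] by blast
  have stable_physical: "lyapunov_stable field skate_physical z"
    if "lyapunov_stable field skate_domain z" for z
    using lyapunov_stable_mono[OF that skate_physical_subset_domain] .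
  \<comment> \<open>Here m l^2 - k = I3 + m l^2 - I2 is negative, so the instability criterion holds
    for every spin rate.\<close>
  have "(m * l^2 - k) * \<Omega>0^2 < m * g * l" if "I3 + m * l^2 < I2"
  proof -
    have "(m * l^2 - k) * \<Omega>0^2 \<le> 0"
      using that by (intro mult_nonpos_nonneg) (auto simp: k_def)
    also have "0 < m * g * l" using pos by simp
    finally show ?thesis .
  qed
  moreover have "(m * l^2 - k) * \<Omega>0^2 > m * g * l"
    if "I3 + m * l^2 > I2" and speed: "\<bar>\<Omega>0\<bar> > sqrt (m * g * l / (I3 + m * l^2 - I2))"
  proof -
    \<comment> \<open>The spin bound is squared by reading |\<Omega>0| as the square root of
      \<Omega>0^2.\<close>
    have "m * g * l / (I3 + m * l^2 - I2) < \<Omega>0^2"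
      using real_sqrt_less_iff[of _ "\<Omega>0^2"] speed by simp
    then show ?thesis
      using that(1) by (simp add: k_def pos_divide_less_eq algebra_simps)
  qed
  ultimately show ?thesis
    using spinning_unstable spinning_stable unstable_domain stable_physical by blast
qed

end
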